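(* Let $n=p_1p_2\cdots p_m\,q_1^{k_1}\cdots q_r^{k_r}$ with $p_1,\dots,p_m,q_1,\dots,q_r$ distinct primes, all $k_j\ge 2$, $m\ge 1$ and $m+r\ge 2$, and let $G=W\Gamma(\mathbb{Z}_n)$ be the weakly zero-divisor graph of $\mathbb{Z}_n$. Then the Sombor energy of $G$ satisfies \[ ESO(G)\ \ge\ \sqrt{2}\,(n-\phi(n)-2)\Bigl(n-\phi(n)-\sum_{i=1}^m\phi\bigl(\tfrac{n}{p_i}\bigr)-2\Bigr), \] where $\phi$ is Euler's totient function.
   Context: For a commutative ring $R$, the weakly zero-divisor graph $W\Gamma(R)$ is the simple undirected graph whose vertices are the nonzero zero-divisors of $R$, two distinct vertices $x,y$ being adjacent iff there exist $w\in\mathrm{ann}(x)$ and $z\in\mathrm{ann}(y)$ with $wz=0$. For a simple graph $G$ with vertices $v_1,\dots,v_N$ and degrees $\mathfrak{d}_{v_i}$, the Sombor matrix $S(G)$ has $(i,j)$ entry $\sqrt{\mathfrak{d}_{v_i}^2+\mathfrak{d}_{v_j}^2}$ if $v_i\sim v_j$ and $0$ otherwise; if $\lambda_1,\dots,\lambda_N$ are its eigenvalues, the Sombor energy is $ESO(G)=\sum_{i=1}^N|\lambda_i|$. *)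

theory Defs
  imports
    "HOL-Number_Theory.Number_Theory"
    "HOL-Computational_Algebra.Fundamental_Theorem_Algebra"
    "Graph_Theory.Pair_Digraph"
    "Jordan_Normal_Form.Char_Poly"
begin

definition annihilator :: "('a, 'b) ring_scheme \<Rightarrow> 'a \<Rightarrow> 'a set" where
  "annihilator R x = {w \<in> carrier R. w \<otimes>\<^bsub>R\<^esub> x = \<zero>\<^bsub>R\<^esub>}"

definition nonzero_zero_divisors :: "('a, 'b) ring_scheme \<Rightarrow> 'a set" where
  "nonzero_zero_divisors R =
     {x \<in> carrier R - {\<zero>\<^bsub>R\<^esub>}. \<exists>y \<in> carrier R - {\<zero>\<^bsub>R\<^esub>}. x \<otimes>\<^bsub>R\<^esub> y = \<zero>\<^bsub>R\<^esub>}"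

text \<open>
  A simple undirected graph is a \<^locale>\<open>pair_graph\<close>: each edge is represented by both of its
  orientations. The annihilating elements are required to be nonzero, as in the literature on
  weakly zero-divisor graphs; with zero allowed, the condition would hold for all pairs
  and the graph would always be complete.
\<close>

definition weakly_zero_divisor_graph :: "('a, 'b) ring_scheme \<Rightarrow> 'a pair_pre_digraph" where
  "weakly_zero_divisor_graph R =
     \<lparr> pverts = nonzero_zero_divisors R,
       parcs = {(x, y). x \<in> nonzero_zero_divisors R \<and> y \<in> nonzero_zero_divisors R \<and> x \<noteq> y \<and>
         (\<exists>w \<in> annihilator R x - {\<zero>\<^bsub>R\<^esub>}. \<exists>z \<in> annihilator R y - {\<zero>\<^bsub>R\<^esub>}.
            w \<otimes>\<^bsub>R\<^esub> z = \<zero>\<^bsub>R\<^esub>)} \<rparr>"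

lemma pair_graph_weakly_zero_divisor_graph:
  assumes "cring R" and "finite (carrier R)"
  shows "pair_graph (weakly_zero_divisor_graph R)"
proof -
  interpret cring R by fact
  let ?G = "weakly_zero_divisor_graph R"
  have "pverts ?G \<subseteq> carrier R"
    by (auto simp: weakly_zero_divisor_graph_def nonzero_zero_divisors_def)
  then have fin: "finite (pverts ?G)"
    using assms(2) finite_subset by blast
  have sub: "parcs ?G \<subseteq> pverts ?G \<times> pverts ?G"
    by (auto simp: weakly_zero_divisor_graph_def)
  then have fin': "finite (parcs ?G)"
    using fin by (meson finite_SigmaI finite_subset)
  have "sym (parcs ?G)"
  proof (rule symI)
    fix x y assume "(x, y) \<in> parcs ?G"
    then obtain w z where
      xy: "x \<in> nonzero_zero_divisors R" "y \<in> nonzero_zero_divisors R" "x \<noteq> y" and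
      w: "w \<in> annihilator R x - {\<zero>\<^bsub>R\<^esub>}" and z: "z \<in> annihilator R y - {\<zero>\<^bsub>R\<^esub>}" and
      wz: "w \<otimes>\<^bsub>R\<^esub> z = \<zero>\<^bsub>R\<^esub>"
      unfolding weakly_zero_divisor_graph_def by auto
    have "z \<otimes>\<^bsub>R\<^esub> w = \<zero>\<^bsub>R\<^esub>"
      using wz w z m_comm[of w z] by (simp add: annihilator_def)
    then show "(y, x) \<in> parcs ?G"
      unfolding weakly_zero_divisor_graph_def using xy w z by auto
  qed
  then have sym: "symmetric (with_proj ?G)"
    by (simp add: symmetric_def)
  show ?thesis
  proof unfold_locales
    show "finite (pverts ?G)" "finite (parcs ?G)" "symmetric (with_proj ?G)"
      by fact+
  qed (use sub in \<open>auto simp: weakly_zero_divisor_graph_def\<close>)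
qed

text \<open>
  In a symmetric digraph without parallel arcs the out-degree is the number of neighbours.
  The list \<open>vs\<close> is an enumeration $v_1,\dots,v_N$ of the vertices.
\<close>

definition sombor_matrix :: "'a pair_pre_digraph \<Rightarrow> 'a list \<Rightarrow> real mat" where
  "sombor_matrix G vs =
     mat (length vs) (length vs)
       (\<lambda>(i, j). if (vs ! i, vs ! j) \<in> parcs G
          then sqrt ((real (out_degree (with_proj G) (vs ! i)))\<^sup>2 +
                     (real (out_degree (with_proj G) (vs ! j)))\<^sup>2)
          else 0)"

text \<open>Eigenvalues are taken in the complex numbers, with algebraic multiplicity.\<close>

definition eigenvalue_mset :: "real mat \<Rightarrow> complex multiset" where
  "eigenvalue_mset A = proots (char_poly (map_mat complex_of_real A))"

definition sombor_energy :: "'a pair_pre_digraph \<Rightarrow> real" where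
  "sombor_energy G =
     (let vs = (SOME vs. distinct vs \<and> set vs = pverts G)
      in \<Sum>l \<in># eigenvalue_mset (sombor_matrix G vs). cmod l)"

lemma char_poly_permute:
  fixes f :: "nat \<Rightarrow> nat \<Rightarrow> 'a :: comm_ring_1"
  assumes p: "p permutes {0..<n}"
  shows "char_poly (mat n n (\<lambda>(i, j). f (p i) (p j))) = char_poly (mat n n (\<lambda>(i, j). f i j))"
    (is "char_poly ?B = char_poly ?A")
proof -
  let ?M = "char_poly_matrix ?A"
  let ?M1 = "mat n n (\<lambda>(i, j). ?M $$ (p i, j))"
  let ?M2 = "mat n n (\<lambda>(i, j). transpose_mat ?M1 $$ (p i, j))"
  have M: "?M \<in> carrier_mat n n" by simp
  have plt: "p i < n" if "i < n" for i
    using permutes_in_image[OF p, of i] that by simp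
  have pinj: "p i = p j \<longleftrightarrow> i = j" for i j
    using permutes_inj[OF p] by (auto dest: injD)
  have "char_poly_matrix ?B = transpose_mat ?M2"
    by (rule eq_matI) (auto simp: char_poly_matrix_def plt pinj)
  then have "char_poly ?B = det ?M2"
    unfolding char_poly_def by (simp add: det_transpose[of _ n])
  also have "\<dots> = signof p * det (transpose_mat ?M1)"
    by (rule det_permute_rows[OF _ p]) simp
  also have "det (transpose_mat ?M1) = det ?M1"
    by (rule det_transpose[of _ n]) simp
  also have "det ?M1 = signof p * det ?M"
    by (rule det_permute_rows[OF M p])
  also have "signof p * (signof p * det ?M) = det ?M"
    by (simp add: sign_def)
  finally show ?thesis
    by (simp add: char_poly_def)
qed

text \<open>The energy does not depend on the enumeration of the vertices.\<close>

lemma sombor_energy_eq: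
  assumes vs: "distinct vs" "set vs = pverts G"
  shows "sombor_energy G = (\<Sum>l \<in># eigenvalue_mset (sombor_matrix G vs). cmod l)"
proof -
  define ws where "ws = (SOME ws. distinct ws \<and> set ws = pverts G)"
  have ws: "distinct ws \<and> set ws = pverts G"
    unfolding ws_def by (rule someI[of _ vs]) (use vs in simp)
  have "mset ws = mset vs"
    using vs ws set_eq_iff_mset_eq_distinct by metis
  then obtain p where p: "p permutes {..<length vs}" and pl: "permute_list p vs = ws"
    by (rule mset_eq_permutation)
  define n where "n = length vs"
  have len: "length ws = n" using pl n_def by auto
  have p': "p permutes {0..<n}" using p by (simp add: n_def lessThan_atLeast0)
  have nth: "ws ! i = vs ! p i" if "i < n" for i
    using pl p that by (auto simp: n_def permute_list_nth)
  define f where "f = (\<lambda>i j. complex_of_real (if (vs ! i, vs ! j) \<in> parcs G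
          then sqrt ((real (out_degree (with_proj G) (vs ! i)))\<^sup>2 +
                     (real (out_degree (with_proj G) (vs ! j)))\<^sup>2)
          else 0))"
  have v: "map_mat complex_of_real (sombor_matrix G vs) = mat n n (\<lambda>(i, j). f i j)"
    by (rule eq_matI) (auto simp: sombor_matrix_def f_def n_def)
  have w: "map_mat complex_of_real (sombor_matrix G ws) = mat n n (\<lambda>(i, j). f (p i) (p j))"
    by (rule eq_matI) (auto simp: sombor_matrix_def f_def len nth)
  have "eigenvalue_mset (sombor_matrix G ws) = eigenvalue_mset (sombor_matrix G vs)"
    unfolding eigenvalue_mset_def v w char_poly_permute[OF p'] ..
  then show ?thesis
    by (simp add: sombor_energy_def ws_def[symmetric] Let_def)
qed

end

(*
  The weakly zero-divisor graph of the integers modulo n is complete up to pairs of distinct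
  vertices x, y with gcd x n = gcd y n = p_i, so the N = n - phi(n) - 1 vertices include at least
  M = N - sum_i phi(n / p_i) that are adjacent to all others and hence have degree N - 1.
  The difference of the unit vectors of two such vertices is an eigenvector of the Sombor matrix
  for the eigenvalue - sqrt 2 * (N - 1), which therefore has multiplicity at least M - 1; these
  eigenvalues alone account for the bound.
*)
theory Submission
  imports Defs
begin

section \<open>Eigenvalue multiplicity from twin rows\<close>

text \<open>Each \<open>e_i - e_0\<close> with \<open>0 < i < k\<close> is a left eigenvector of
  \<open>A\<close> for \<open>- c\<close>. Factoring the characteristic matrix instead of using
  eigenvectors yields the algebraic multiplicity directly, which is what
  \<open>eigenvalue_mset\<close> records.\<close>

lemma char_poly_twin_rows_dvd:
  fixes A :: "'a :: comm_ring_1 mat"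
  assumes A: "A \<in> carrier_mat n n" and "k \<le> n"
    and diag: "\<And>i. i < k \<Longrightarrow> A $$ (i, i) = 0"
    and block: "\<And>i j. i < k \<Longrightarrow> j < k \<Longrightarrow> i \<noteq> j \<Longrightarrow> A $$ (i, j) = c"
    and rest: "\<And>i j. i < k \<Longrightarrow> k \<le> j \<Longrightarrow> j < n \<Longrightarrow> A $$ (i, j) = A $$ (0, j)"
  shows "[:c, 1:] ^ (k - 1) dvd char_poly A"
proof -
  \<comment> \<open>Subtracting row 0 of the characteristic matrix from row \<open>i < k\<close> leaves
    \<open>(X + c) (e_i - e_0)\<close>; \<open>L\<close> undoes this row operation and carries the factors \<open>X + c\<close>.\<close>
  let ?M = "char_poly_matrix A"
  define a where "a i = (if 0 < i \<and> i < k then [:c, 1:] else 1)" for i :: nat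
  define b where "b i = (if 0 < i \<and> i < k then 1 else 0 :: 'a poly)" for i :: nat
  define L where "L = mat n n (\<lambda>(i, l). (if l = i then a i else 0) + (if l = 0 then b i else 0))"
  define C where "C = mat n n (\<lambda>(i, j). if 0 < i \<and> i < k
    then (if j = i then 1 else if j = 0 then - 1 else 0) else ?M $$ (i, j))"
  have L: "L \<in> carrier_mat n n" and C: "C \<in> carrier_mat n n"
    by (simp_all add: L_def C_def)
  have M: "?M $$ (i, j) = (if i = j then [:0, 1:] else 0) + [:- A $$ (i, j):]"
    if "i < n" "j < n" for i j
    using A that by (simp add: char_poly_matrix_def)
  have "?M = L * C"
  proof (rule eq_matI)
    fix i j assume ij: "i < dim_row (L * C)" "j < dim_col (L * C)"
    then have i: "i < n" and j: "j < n" using L C by auto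
    have "(L * C) $$ (i, j) = (\<Sum>l = 0..<n. L $$ (i, l) * C $$ (l, j))"
      using i j L C by (simp add: scalar_prod_def)
    also have "\<dots> = (\<Sum>l = 0..<n. (if l = i then a i * C $$ (i, j) else 0) +
        (if l = 0 then b i * C $$ (0, j) else 0))"
      using i by (intro sum.cong refl) (auto simp: L_def algebra_simps)
    also have "\<dots> = a i * C $$ (i, j) + b i * C $$ (0, j)"
      using i by (simp add: sum.distrib)
    also have "\<dots> = ?M $$ (i, j)"
    proof (cases "0 < i \<and> i < k")
      case False
      then show ?thesis using i j by (auto simp: a_def b_def C_def)
    next
      case True
      then have k: "0 < k" and n: "0 < n" using i by auto
      show ?thesis
        using True i j k n diag[of i] diag[of 0] block[of i j] block[of 0 j] block[of i 0] rest[of i j]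
        by (cases "j < k") (auto simp: a_def b_def C_def M)
    qed
    finally show "?M $$ (i, j) = (L * C) $$ (i, j)" ..
  qed (use A L C in \<open>auto simp: char_poly_matrix_def\<close>)
  then have "char_poly A = det L * det C"
    unfolding char_poly_def using det_mult[OF L C] by simp
  moreover have "det L = (\<Prod>i = 0..<n. L $$ (i, i))"
    using det_lower_triangular[OF _ L] L by (auto simp: L_def prod_list_diag_prod)
  \<comment> \<open>The entries \<open>b i\<close> lie in column 0 and \<open>b 0 = 0\<close>, so
    none of them reaches the diagonal. Row 0 carries no factor, whence the exponent
    \<open>k - 1\<close>.\<close>
  moreover have "(\<Prod>i = 0..<n. L $$ (i, i)) = (\<Prod>i = 0..<n. a i)"
    by (rule prod.cong) (auto simp: L_def b_def)
  moreover have "(\<Prod>i = 0..<n. a i) = (\<Prod>i = 1..<k. [:c, 1:])"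
    using \<open>k \<le> n\<close> by (intro prod.mono_neutral_cong_right) (auto simp: a_def)
  ultimately show ?thesis by simp
qed

lemma count_mult_le_sum_mset:
  fixes f :: "'a \<Rightarrow> real"
  assumes "\<And>x. 0 \<le> f x"
  shows "real (count M a) * f a \<le> (\<Sum>x\<in>#M. f x)"
proof -
  have "replicate_mset (count M a) a \<subseteq># M"
    using count_le_replicate_mset_subset_eq by fastforce
  then obtain K where "M = replicate_mset (count M a) a + K"
    by (metis subset_mset.add_diff_inverse)
  then have "(\<Sum>x\<in>#M. f x) = real (count M a) * f a + (\<Sum>x\<in>#K. f x)"
    by (metis image_mset_union image_replicate_mset sum_mset.union sum_mset_replicate_mset)
  moreover have "0 \<le> (\<Sum>x\<in>#K. f x)"
    using assms by (induction K) auto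
  ultimately show ?thesis by simp
qed

section \<open>Sombor energy and dominating vertices\<close>

lemma (in pair_graph) out_degree_dominating_vertex:
  assumes "v \<in> pverts G" and "\<And>w. w \<in> pverts G \<Longrightarrow> w \<noteq> v \<Longrightarrow> (v, w) \<in> parcs G"
  shows "out_degree (with_proj G) v = card (pverts G) - 1"
proof -
  have "out_arcs (with_proj G) v = Pair v ` (pverts G - {v})"
    using assms no_loops' in_arcsD2 by (fastforce simp: out_arcs_def)
  then show ?thesis
    using assms by (simp add: out_degree_def card_image inj_on_def)
qed

text \<open>All vertices of \<open>S\<close> have the same degree and are adjacent to everything
  else, so in their rows an off-diagonal entry depends only on the degree of the column vertex.
  These rows are therefore twins.\<close>

lemma (in pair_graph) sombor_energy_ge_dominating:
  assumes S: "S \<subseteq> pverts G"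
    and dom: "\<And>v w. v \<in> S \<Longrightarrow> w \<in> pverts G \<Longrightarrow> v \<noteq> w \<Longrightarrow> (v, w) \<in> parcs G"
  shows "sqrt 2 * real (card (pverts G) - 1) * real (card S - 1) \<le> sombor_energy G"
proof -
  define d where "d = real (card (pverts G) - 1)"
  define c where "c = sqrt 2 * d"
  obtain xs where xs: "set xs = S" "distinct xs"
    using finite_distinct_list[OF finite_subset[OF S]] by auto
  obtain ys where ys: "set ys = pverts G - S" "distinct ys"
    using finite_distinct_list[of "pverts G - S"] by auto
  \<comment> \<open>Listing \<open>S\<close> first makes the twin rows the leading \<open>k\<close>
    rows; \<open>sombor_energy_eq\<close> permits any enumeration.\<close>
  define vs where "vs = xs @ ys"
  have vs: "distinct vs" "set vs = pverts G"
    using xs ys S by (auto simp: vs_def)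
  define n k where "n = length vs" and "k = length xs"
  have k: "k \<le> n" "k = card S"
    using xs by (auto simp: n_def k_def vs_def distinct_card)
  have inS: "vs ! i \<in> S" if "i < k" for i
    using that xs by (auto simp: vs_def k_def nth_append)
  have deg: "real (out_degree (with_proj G) v) = d" if "v \<in> S" for v
    using that out_degree_dominating_vertex[of v] S dom by (auto simp: d_def)
  have adj: "(vs ! i, vs ! j) \<in> parcs G" if "i < k" "j < n" "i \<noteq> j" for i j
    using that dom[OF inS, of i "vs ! j"] vs k
    by (metis n_def nth_eq_iff_index_eq nth_mem order_less_le_trans)
  define A where "A = map_mat complex_of_real (sombor_matrix G vs)"
  have A: "A \<in> carrier_mat n n"
    by (simp add: A_def sombor_matrix_def n_def)
  have "0 \<le> c" by (simp add: c_def d_def)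
  have "sqrt (d\<^sup>2 + d\<^sup>2) = c"
    by (simp add: c_def real_sqrt_mult d_def flip: mult_2)
  then have dvd: "[:complex_of_real c, 1:] ^ (k - 1) dvd char_poly A"
    using k(1) no_loops'
    by (intro char_poly_twin_rows_dvd[OF A])
      (auto simp: A_def sombor_matrix_def n_def[symmetric] adj deg inS)
  have "char_poly A \<noteq> 0"
    using degree_monic_char_poly[OF A] by auto
  with dvd have "k - 1 \<le> order (- complex_of_real c) (char_poly A)"
    using order_divides[of "- complex_of_real c" "k - 1" "char_poly A"] by simp
  then have "real (k - 1) * c \<le>
      real (count (eigenvalue_mset (sombor_matrix G vs)) (- complex_of_real c)) *
      cmod (- complex_of_real c)"
    using \<open>char_poly A \<noteq> 0\<close> \<open>0 \<le> c\<close>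
    by (intro mult_mono) (auto simp: eigenvalue_mset_def simp flip: A_def)
  also have "\<dots> \<le> sombor_energy G"
    unfolding sombor_energy_eq[OF vs] by (rule count_mult_le_sum_mset) simp
  finally show ?thesis
    by (simp add: c_def d_def k mult_ac)
qed

section \<open>Vertices and edges over the integers modulo n\<close>

text \<open>If \<open>x\<close> is coprime to \<open>n\<close>, then \<open>n dvd x * y\<close>
  forces \<open>n dvd y\<close>. Otherwise \<open>n div gcd x n\<close> is a nonzero residue that
  kills \<open>x\<close>.\<close>

lemma nonzero_zero_divisors_residue_ring:
  "nonzero_zero_divisors (residue_ring (int n)) = int ` {x \<in> {0<..<n}. \<not> coprime x n}"
    (is "nonzero_zero_divisors ?R = int ` ?V")
proof (intro equalityI subsetI)
  fix z assume "z \<in> nonzero_zero_divisors ?R"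
  then obtain w where "z \<in> carrier ?R - {\<zero>\<^bsub>?R\<^esub>}" "w \<in> carrier ?R - {\<zero>\<^bsub>?R\<^esub>}"
      "z \<otimes>\<^bsub>?R\<^esub> w = \<zero>\<^bsub>?R\<^esub>"
    unfolding nonzero_zero_divisors_def by blast
  then have *: "0 < z" "z < int n" "0 < w" "w < int n" "int n dvd z * w"
    by (auto simp: residue_ring_def)
  define x y where "x = nat z" and "y = nat w"
  have xy: "z = int x" "w = int y" using * by (auto simp: x_def y_def)
  have "n dvd x * y"
    using *(5) unfolding xy by (metis of_nat_dvd_iff of_nat_mult)
  moreover have "\<not> n dvd y"
    using * xy by (auto dest: dvd_imp_le)
  ultimately have "\<not> coprime x n"
    using coprime_dvd_mult_right_iff coprime_commute by blast
  then show "z \<in> int ` ?V" using * xy by auto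
next
  fix z assume "z \<in> int ` ?V"
  then obtain x where x: "z = int x" "0 < x" "x < n" "\<not> coprime x n" by auto
  define g where "g = gcd x n"
  have "g \<noteq> 0" using x(2) by (simp add: g_def)
  moreover have "g \<noteq> 1" using x(4) unfolding g_def coprime_iff_gcd_eq_1 .
  ultimately have "g > 1" by linarith
  moreover have "g dvd x" "g dvd n" by (simp_all add: g_def)
  ultimately have g: "g dvd x" "g dvd n" "g > 1" by simp_all
  have "n dvd x * (n div g)"
    using g by (metis dvd_div_mult_self dvd_mult_right mult.commute mult_dvd_mono dvd_refl)
  then have "z * int (n div g) mod int n = 0"
    unfolding x by (metis dvd_imp_mod_0 of_nat_dvd_iff of_nat_mult)
  moreover have "0 < n div g" "n div g < n"
    using g x by (auto simp: dvd_div_eq_0_iff intro!: Nat.gr0I)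
  ultimately show "z \<in> nonzero_zero_divisors ?R"
    using x
    by (auto simp: nonzero_zero_divisors_def residue_ring_def intro!: bexI[of _ "int (n div g)"])
qed

lemma card_nonunits:
  assumes "1 < n"
  shows "card {x \<in> {0<..<n}. \<not> coprime x n} = n - totient n - 1"
proof -
  have "{x \<in> {0<..<n}. \<not> coprime x n} = {0<..n} - totatives n - {n}"
    by (auto simp: totatives_def)
  \<comment> \<open>The number \<open>n\<close> represents the zero residue. As \<open>1 < n\<close>
    it is not a totative, so removing it costs exactly the final 1.\<close>
  moreover have "n \<in> {0<..n} - totatives n"
    using assms by (simp add: totatives_def)
  moreover have "card ({0<..n} - totatives n) = n - totient n"
    by (subst card_Diff_subset) (auto simp: totatives_def totient_def)
  ultimately show ?thesis by simp
qed

lemma div_in_annihilator_residue_ring: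
  assumes "0 < n" "prime t" "t dvd x" "t dvd n"
  shows "int (n div t) \<in> annihilator (residue_ring (int n)) (int x) - {\<zero>\<^bsub>residue_ring (int n)\<^esub>}"
proof -
  have "0 < n div t" "n div t < n"
    using assms prime_gt_1_nat[of t] by (auto simp: dvd_div_eq_0_iff intro!: Nat.gr0I)
  moreover have "n dvd n div t * x"
    using assms by (metis dvd_div_mult_self mult_dvd_mono dvd_refl)
  then have "int (n div t) * int x mod int n = 0"
    by (metis dvd_imp_mod_0 of_nat_dvd_iff of_nat_mult)
  ultimately show ?thesis
    by (simp add: annihilator_def residue_ring_def)
qed

text \<open>For primes \<open>t\<close> and \<open>s\<close> dividing \<open>gcd x n\<close> and
  \<open>gcd y n\<close>, the elements \<open>n div t\<close> and \<open>n div s\<close> annihilate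
  \<open>x\<close> and \<open>y\<close>, and their product vanishes modulo \<open>n\<close> once
  \<open>t * s dvd n\<close>. The hypothesis \<open>sq\<close> handles the case where
  \<open>t = s\<close> is forced and \<open>gcd x n\<close> is just this prime.\<close>

lemma weakly_zero_divisor_graph_residue_ring_adjacent:
  assumes x: "x \<in> {0<..<n}" "\<not> coprime x n" and y: "y \<in> {0<..<n}" "\<not> coprime y n"
    and "x \<noteq> y"
    and sq: "prime (gcd x n) \<Longrightarrow> (gcd x n)\<^sup>2 dvd n"
  shows "(int x, int y) \<in> parcs (weakly_zero_divisor_graph (residue_ring (int n)))"
proof -
  have n: "0 < n" using x by auto
  obtain s where s: "prime s" "s dvd y" "s dvd n"
    using y(2) by (metis coprime_iff_gcd_eq_1 gcd_greatest_iff prime_factor_nat)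
  \<comment> \<open>With \<open>s\<close> fixed, a prime \<open>t\<close> different from
    \<open>s\<close> is preferred, since then \<open>t\<close> and \<open>s\<close> are coprime
    divisors of \<open>n\<close>.\<close>
  obtain t where t: "prime t" "t dvd x" "t dvd n" and ts: "t * s dvd n"
  proof (cases "\<exists>t. prime t \<and> t dvd gcd x n \<and> t \<noteq> s")
    case True
    then obtain t where t: "prime t" "t dvd x" "t dvd n" "t \<noteq> s" by auto
    then have "t * s dvd n"
      using s by (intro divides_mult) (auto intro: primes_coprime)
    with t that show ?thesis by blast
  next
    case False
    obtain u where "prime u" "u dvd gcd x n"
      using x(2) by (metis coprime_iff_gcd_eq_1 prime_factor_nat)
    \<comment> \<open>Here \<open>s\<close> is the only prime divisor of \<open>gcd x n\<close>:
      either the gcd equals \<open>s\<close> and \<open>sq\<close> applies, or it is already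
      divisible by the square of \<open>s\<close>.\<close>
    with False have sg: "s dvd gcd x n" by blast
    have "s\<^sup>2 dvd n"
    proof (cases "gcd x n = s")
      case True
      then show ?thesis using sq s by simp
    next
      case neq: False
      obtain h where h: "gcd x n = s * h" using sg by (elim dvdE)
      with neq have "h \<noteq> 1" by auto
      then obtain u where u: "prime u" "u dvd h" using prime_factor_nat by blast
      then have "u dvd gcd x n" using h by simp
      with u False have "u = s" by blast
      then have "s\<^sup>2 dvd gcd x n" using h u by (simp add: power2_eq_square)
      then show ?thesis by simp
    qed
    with sg s that show ?thesis by (auto simp: power2_eq_square)
  qed
  have "n * (t * s) dvd n * n" using ts by simp
  moreover have "n * n = (n div t * (n div s)) * (t * s)"
    using t s by (metis dvd_div_mult_self mult.assoc mult.commute)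
  ultimately have "n dvd n div t * (n div s)"
    using t s by (auto dest: prime_gt_0_nat)
  then have "int (n div t) * int (n div s) mod int n = 0"
    by (metis dvd_imp_mod_0 of_nat_dvd_iff of_nat_mult)
  then have "int (n div t) \<otimes>\<^bsub>residue_ring (int n)\<^esub> int (n div s) = \<zero>\<^bsub>residue_ring (int n)\<^esub>"
    by (simp add: residue_ring_def)
  then show ?thesis
    using div_in_annihilator_residue_ring[OF n t] div_in_annihilator_residue_ring[OF n s] x y \<open>x \<noteq> y\<close>
    unfolding weakly_zero_divisor_graph_def nonzero_zero_divisors_residue_ring by auto
qed

section \<open>Counting dominating vertices\<close>

theorem theorem3p5:
  fixes p q k :: "nat \<Rightarrow> nat" and m r n :: nat
  assumes n: "n = (\<Prod>i=1..m. p i) * (\<Prod>j=1..r. q j ^ k j)"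
    and p_prime: "\<And>i. i \<in> {1..m} \<Longrightarrow> prime (p i)"
    and q_prime: "\<And>j. j \<in> {1..r} \<Longrightarrow> prime (q j)"
    and p_inj: "inj_on p {1..m}"
    and q_inj: "inj_on q {1..r}"
    and pq_disj: "p ` {1..m} \<inter> q ` {1..r} = {}"
    and k_ge: "\<And>j. j \<in> {1..r} \<Longrightarrow> k j \<ge> 2"
    and m_ge: "m \<ge> 1"
    and mr_ge: "m + r \<ge> 2"
  shows "sombor_energy (weakly_zero_divisor_graph (residue_ring (int n)))
    \<ge> sqrt 2 * (real n - real (totient n) - 2) *
        (real n - real (totient n) - (\<Sum>i=1..m. real (totient (n div p i))) - 2)"
proof -
  define G where "G = weakly_zero_divisor_graph (residue_ring (int n))"
  define V where "V = {x \<in> {0<..<n}. \<not> coprime x n}"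
  \<comment> \<open>These are the vertices that may fail to dominate; \<open>V - B\<close> will
    serve as the dominating set.\<close>
  define B where "B = {x \<in> V. gcd x n \<in> p ` {1..m}}"
  have n0: "n > 0"
    unfolding n using p_prime q_prime
    by (intro mult_pos_pos prod_pos zero_less_power ballI prime_gt_0_nat)
  have p_dvd: "p i dvd n" if "i \<in> {1..m}" for i
    unfolding n using that by (intro dvd_mult2 dvd_prodI) auto
  have q_sq: "(q j)\<^sup>2 dvd n" if "j \<in> {1..r}" for j
  proof -
    have "(q j)\<^sup>2 dvd q j ^ k j" using k_ge[OF that] by (rule le_imp_power_dvd)
    also have "\<dots> dvd n" unfolding n using that by (intro dvd_mult dvd_prodI) auto
    finally show ?thesis .
  qed
  have p1: "prime (p 1)" "p 1 dvd n" using p_prime p_dvd m_ge by auto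
  \<comment> \<open>A second prime divisor of \<open>n\<close> makes \<open>p 1\<close> a vertex.
    Nonemptiness of \<open>V\<close> is what lets the truncated \<open>card V - 1\<close> equal the
    real number \<open>n - totient n - 2\<close>.\<close>
  have "n \<noteq> p 1"
  proof
    assume eq: "n = p 1"
    obtain s where "prime s" "s dvd n" "s \<noteq> p 1"
    proof (cases "r \<ge> 1")
      case True
      then have "q 1 dvd n" "prime (q 1)"
        using q_sq[of 1] q_prime by (auto simp: power2_eq_square dest: dvd_mult_left)
      moreover have "p 1 \<in> p ` {1..m}" "q 1 \<in> q ` {1..r}"
        using m_ge True by auto
      then have "q 1 \<noteq> p 1" using pq_disj by auto
      ultimately
      show ?thesis using that by blast
    next
      case False
      then have "2 \<in> {1..m}" using mr_ge by auto
      then have "p 2 \<noteq> p 1" using inj_onD[OF p_inj, of 2 1] m_ge by auto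
      then show ?thesis using that p_dvd p_prime \<open>2 \<in> {1..m}\<close> by blast
    qed
    then show False using eq p1 primes_dvd_imp_eq by blast
  qed
  then have p1V: "p 1 \<in> V"
    using dvd_imp_le[OF p1(2) n0] prime_gt_1_nat[OF p1(1)] coprime_absorb_left[OF p1(2)]
    by (simp add: V_def)
  have n1: "1 < n" using p1V prime_gt_1_nat[OF p1(1)] by (auto simp: V_def)
  interpret residues "int n" "residue_ring (int n)"
    using n1 by unfold_locales auto
  interpret pair_graph G
    unfolding G_def by (rule pair_graph_weakly_zero_divisor_graph[OF cring finite])
  have finV: "finite V" by (simp add: V_def)
  have verts: "pverts G = int ` V"
    by (simp add: G_def weakly_zero_divisor_graph_def nonzero_zero_divisors_residue_ring V_def)
  then have cardG: "card (pverts G) = card V"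
    by (simp add: card_image)
  have cardV: "card V = n - totient n - 1"
    unfolding V_def by (rule card_nonunits[OF n1])
  have "card V > 0" using p1V finV by (auto simp: card_gt_0_iff)
  then have N: "real (card V - 1) = real n - real (totient n) - 2"
    unfolding cardV by linarith
  \<comment> \<open>Writing \<open>x = p i * y\<close>, the condition \<open>gcd x n = p i\<close>
    says that \<open>y\<close> is coprime to \<open>n div p i\<close>, so each fibre has
    \<open>totient (n div p i)\<close> elements.\<close>
  have "B \<subseteq> (\<Union>i\<in>{1..m}. {x \<in> {0<..n}. gcd x n = p i})"
    by (auto simp: B_def V_def)
  then have "card B \<le> card (\<Union>i\<in>{1..m}. {x \<in> {0<..n}. gcd x n = p i})"
    by (intro card_mono) auto
  also have "\<dots> \<le> (\<Sum>i=1..m. card {x \<in> {0<..n}. gcd x n = p i})"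
    by (rule card_UN_le) simp
  also have "\<dots> = (\<Sum>i=1..m. totient (n div p i))"
    using n0 p_dvd by (intro sum.cong refl card_gcd_eq_totient) auto
  finally have cardB: "real (card B) \<le> (\<Sum>i=1..m. real (totient (n div p i)))"
    by (metis of_nat_le_iff of_nat_sum)
  have "B \<subseteq> V" by (auto simp: B_def)
  then have cardS: "card (int ` (V - B)) = card V - card B" "card B \<le> card V"
    using finV by (auto simp: card_image card_Diff_subset finite_subset card_mono)
  \<comment> \<open>A prime divisor of \<open>n\<close> other than the \<open>p i\<close> is some
    \<open>q j\<close>, whose exponent is at least 2. This supplies the hypothesis of the adjacency
    lemma outside \<open>B\<close>.\<close>
  have sq: "s\<^sup>2 dvd n" if s: "prime s" "s dvd n" "s \<notin> p ` {1..m}" for s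
  proof -
    have "\<not> s dvd (\<Prod>i=1..m. p i)"
    proof
      assume "s dvd (\<Prod>i=1..m. p i)"
      then obtain i where "i \<in> {1..m}" "s dvd p i"
        using s(1) by (auto simp: prime_dvd_prod_iff)
      then show False using s p_prime primes_dvd_imp_eq by blast
    qed
    then have "s dvd (\<Prod>j=1..r. q j ^ k j)"
      using s(1,2) by (simp add: n prime_dvd_mult_iff)
    then obtain j where j: "j \<in> {1..r}" "s dvd q j ^ k j"
      using s(1) by (auto simp: prime_dvd_prod_iff)
    then have "s = q j"
      using s(1) q_prime prime_dvd_power primes_dvd_imp_eq by blast
    then show ?thesis using q_sq j by simp
  qed
  have energy: "sqrt 2 * real (card (pverts G) - 1) * real (card (int ` (V - B)) - 1)
      \<le> sombor_energy G"
  proof (rule sombor_energy_ge_dominating)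
    fix v w assume vw: "v \<in> int ` (V - B)" "w \<in> pverts G" "v \<noteq> w"
    then obtain x y where xy: "v = int x" "w = int y" "x \<in> V" "x \<notin> B" "y \<in> V" "x \<noteq> y"
      unfolding verts by blast
    then have "gcd x n \<notin> p ` {1..m}" by (simp add: B_def)
    then show "(v, w) \<in> parcs G"
      unfolding G_def xy using xy sq[of "gcd x n"]
      by (intro weakly_zero_divisor_graph_residue_ring_adjacent) (auto simp: V_def)
  qed (auto simp: verts)
  let ?R = "real n - real (totient n) - (\<Sum>i=1..m. real (totient (n div p i))) - 2"
  \<comment> \<open>\<open>?R\<close> can be negative, for instance when \<open>n = 6\<close>;
    truncation at 0 only enlarges the right-hand side.\<close>
  have "?R \<le> real (card (int ` (V - B)) - 1)"
    using N cardB cardS \<open>card V > 0\<close> by linarith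
  then have "sqrt 2 * (real n - real (totient n) - 2) * ?R
      \<le> sqrt 2 * real (card (pverts G) - 1) * real (card (int ` (V - B)) - 1)"
    unfolding N[symmetric] cardG by (intro mult_left_mono) auto
  then show ?thesis
    using energy unfolding G_def by (rule order_trans)
qed

end
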